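(* Let $\alpha\in\mathbb Z\setminus\{0,1\}$ and let $(h_n)$ be the sequence with $h_0=0$, $h_1=1$, $h_2=-\alpha^3(\alpha-1)(2\alpha-1)$, $h_3=-\alpha^8(\alpha-1)^3(2\alpha-1)^3$, $h_4=\alpha^{14}(\alpha-1)^6(2\alpha-1)^6$, and for $m\ge2$: $h_{2m+1}=h_{m+2}h_m^3-h_{m-1}h_{m+1}^3$, for $m\ge 3$: $h_{2m}=h_m\big(h_{m+2}h_{m-1}^2-h_{m-2}h_{m+1}^2\big)/h_2$. (i) If $n\equiv 1,7,17,23\pmod{24}$, then $h_n$ is a cube. (ii) If $n\equiv 3,4,20,21\pmod{24}$, then $h_n$ is a cube if and only if $\alpha$ is a cube. (iii) If $n\equiv 6,18\pmod{24}$, then $h_n$ is a cube if and only if $2\alpha-1$ is a cube. (iv) If $n\equiv 9,15\pmod{24}$, then $h_n$ is a cube if and only if $\alpha-1$ is a cube.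
   Context: The sequence defined is the elliptic divisibility sequence attached to the point $(0,0)$ of order $8$ on the curve $y^2+(\alpha-\xi)xy-\alpha^3\xi y=x^3-\alpha^2\xi x^2$ with $\xi=(2\alpha-1)(\alpha-1)$. Convention: an integer $m$ is called a cube if $m=\beta^3$ for some nonzero integer $\beta$. *)

theory Defs
  imports Complex_Main "HOL-Number_Theory.Cong"
begin

text \<open>
  The zero integer is excluded by convention. The predicate is polymorphic so that it applies to
  integers as well as to the terms of a rational sequence; a rational number satisfying it is
  necessarily an integer.
\<close>

definition is_cube :: "'a::ring_1 \<Rightarrow> bool" where
  "is_cube x \<longleftrightarrow> (\<exists>\<beta>::int. \<beta> \<noteq> 0 \<and> x = of_int (\<beta> ^ 3))"

end

theory Submission
  imports Defs
begin

text \<open>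
  The point \<open>(0,0)\<close> has order 8, so the sequence is quasi-periodic: with
  \<open>V = - (\<alpha>\<^bsup>15\<^esup> (\<alpha> - 1)\<^bsup>7\<^esup> (2\<alpha> - 1)\<^bsup>6\<^esup>)\<close> one has \<open>h\<^bsub>n+8\<^esub> = - V\<^bsup>n+4\<^esup> h\<^bsub>n\<^esub>\<close>.
  Both recurrences are compatible with this scaling, so it suffices to check it for
  \<open>n \<le> 12\<close>. Three steps give \<open>h\<^bsub>n+24\<^esub> = (- V\<^bsup>n+12\<^esup>)\<^sup>3 h\<^bsub>n\<^esub>\<close>, so whether \<open>h\<^bsub>n\<^esub>\<close> is a cube depends only
  on \<open>n mod 24\<close>, and the nonzero terms among the first 24 are,
  up to sign, monomials in \<open>\<alpha>\<close>, \<open>\<alpha> - 1\<close>, \<open>2\<alpha> - 1\<close>.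
\<close>

section \<open>Explicit terms of the sequence as monomials\<close>

text \<open>A field is used because the even recurrence divides by \<open>h 2\<close>. Keeping
  \<open>b\<close> and \<open>c\<close> as separate parameters lets every term be written as a
  monomial in \<open>a\<close>, \<open>b\<close>, \<open>c\<close>.\<close>

locale order_8_eds =
  fixes a b c :: "'a::field" and h :: "nat \<Rightarrow> 'a"
  assumes b_eq: "b = a - 1"
    and c_eq: "c = 2 * a - 1"
    and a_nz: "a \<noteq> 0" and b_nz: "b \<noteq> 0" and c_nz: "c \<noteq> 0"
    and h0: "h 0 = 0"
    and h1: "h 1 = 1"
    and h2: "h 2 = - (a ^ 3 * b * c)"
    and h3: "h 3 = - (a ^ 8 * b ^ 3 * c ^ 3)"
    and h4: "h 4 = a ^ 14 * b ^ 6 * c ^ 6"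
    and h_odd: "m \<ge> 2 \<Longrightarrow> h (2 * m + 1) = h (m + 2) * h m ^ 3 - h (m - 1) * h (m + 1) ^ 3"
    and h_even: "m \<ge> 3 \<Longrightarrow>
      h (2 * m) = h m * (h (m + 2) * h (m - 1) ^ 2 - h (m - 2) * h (m + 1) ^ 2) / h 2"
begin

text \<open>These are the binomials that remain in the terms 5, 6, 7, 9, 10, 11 after the common
  monomial is split off. The key one is \<open>a\<^sup>2 - c\<close>, a perfect square because
  \<open>c = 2 * a - 1\<close>.\<close>

lemma factor_eqs:
  "a - 1 = b" "1 - a = - b" "c - a = b" "a - c = - b" "c - a\<^sup>2 = - b\<^sup>2" "a\<^sup>2 - c = b\<^sup>2"
  by (simp_all add: b_eq c_eq power2_eq_square algebra_simps)

lemma h2_nz: "h 2 \<noteq> 0"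
  using a_nz b_nz c_nz by (simp add: h2)

text \<open>Multiplying by the nonzero \<open>h 2\<close> turns the even recurrence into a
  polynomial identity to be checked for a guessed value \<open>x\<close>.\<close>

lemma h_evenI:
  assumes "m \<ge> 3"
    and "x * h 2 = h m * (h (m + 2) * h (m - 1) ^ 2 - h (m - 2) * h (m + 1) ^ 2)"
  shows "h (2 * m) = x"
  unfolding h_even[OF assms(1)] assms(2)[symmetric] using h2_nz by simp

text \<open>
  In the next proofs the common monomial is split off before \<open>b = a - 1\<close> and \<open>c = 2a - 1\<close> are
  used, because expanding the powers of \<open>b\<close> and \<open>c\<close> is not feasible.
\<close>

lemma h5: "h 5 = a ^ 23 * b ^ 10 * c ^ 9"
proof -
  have "h 5 = h 4 * h 2 ^ 3 - h 1 * h 3 ^ 3"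
    using h_odd[of 2] by simp
  also have "\<dots> = a ^ 23 * b ^ 9 * c ^ 9 * (a - 1)"
    unfolding h1 h2 h3 h4 by algebra
  also have "\<dots> = a ^ 23 * b ^ 10 * c ^ 9"
    unfolding factor_eqs by algebra
  finally show ?thesis .
qed

lemma h6: "h 6 = - (a ^ 33 * b ^ 15 * c ^ 13)"
proof -
  have "(- (a ^ 33 * b ^ 15 * c ^ 13)) * h 2 = a ^ 36 * b ^ 15 * c ^ 14 * (c - a)"
    unfolding h2 factor_eqs by algebra
  also have "\<dots> = h 3 * (h 5 * h 2 ^ 2 - h 1 * h 4 ^ 2)"
    unfolding h1 h2 h3 h4 h5 by algebra
  finally show ?thesis
    using h_evenI[of 3] by simp
qed

lemma h7: "h 7 = - (a ^ 45 * b ^ 21 * c ^ 18)"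
proof -
  have "h 7 = h 5 * h 3 ^ 3 - h 2 * h 4 ^ 3"
    using h_odd[of 3] by simp
  also have "\<dots> = a ^ 45 * b ^ 19 * c ^ 18 * (c - a\<^sup>2)"
    unfolding h2 h3 h4 h5 by algebra
  also have "\<dots> = - (a ^ 45 * b ^ 21 * c ^ 18)"
    unfolding factor_eqs by algebra
  finally show ?thesis .
qed

text \<open>This is the order 8 of the point: the two products in the bracket are the same monomial.
  Since \<open>h 8\<close> enters the recurrence of each term from 12 to 20, at most one monomial
  survives there and no binomial has to be factored.\<close>

lemma h8: "h 8 = 0"
proof -
  have "0 * h 2 = h 4 * (h 6 * h 3 ^ 2 - h 2 * h 5 ^ 2)"
    unfolding h2 h3 h4 h5 h6 by algebra
  then show ?thesis
    using h_evenI[of 4] by simp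
qed

lemma h9: "h 9 = a ^ 75 * b ^ 35 * c ^ 30"
proof -
  have "h 9 = h 6 * h 4 ^ 3 - h 3 * h 5 ^ 3"
    using h_odd[of 4] by simp
  also have "\<dots> = a ^ 75 * b ^ 33 * c ^ 30 * (a\<^sup>2 - c)"
    unfolding h3 h4 h5 h6 by algebra
  also have "\<dots> = a ^ 75 * b ^ 35 * c ^ 30"
    unfolding factor_eqs by algebra
  finally show ?thesis .
qed

lemma h10: "h 10 = a ^ 93 * b ^ 43 * c ^ 37"
proof -
  have "(a ^ 93 * b ^ 43 * c ^ 37) * h 2 = a ^ 96 * b ^ 43 * c ^ 38 * (a - c)"
    unfolding h2 factor_eqs by algebra
  also have "\<dots> = h 5 * (h 7 * h 4 ^ 2 - h 3 * h 6 ^ 2)"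
    unfolding h2 h3 h4 h5 h6 h7 by algebra
  finally show ?thesis
    using h_evenI[of 5] by simp
qed

lemma h11: "h 11 = - (a ^ 113 * b ^ 52 * c ^ 45)"
proof -
  have "h 11 = h 7 * h 5 ^ 3 - h 4 * h 6 ^ 3"
    using h_odd[of 5] by simp
  also have "\<dots> = a ^ 113 * b ^ 51 * c ^ 45 * (1 - a)"
    unfolding h4 h5 h6 h7 by algebra
  also have "\<dots> = - (a ^ 113 * b ^ 52 * c ^ 45)"
    unfolding factor_eqs by algebra
  finally show ?thesis .
qed

lemma h12: "h 12 = - (a ^ 134 * b ^ 62 * c ^ 54)"
proof -
  have "(- (a ^ 134 * b ^ 62 * c ^ 54)) * h 2 = h 6 * (h 8 * h 5 ^ 2 - h 4 * h 7 ^ 2)"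
    unfolding h2 h4 h5 h6 h7 h8 by algebra
  then show ?thesis
    using h_evenI[of 6] by simp
qed

lemma h13: "h 13 = a ^ 158 * b ^ 73 * c ^ 63"
proof -
  have "h 13 = h 8 * h 6 ^ 3 - h 5 * h 7 ^ 3"
    using h_odd[of 6] by simp
  also have "\<dots> = a ^ 158 * b ^ 73 * c ^ 63"
    unfolding h5 h6 h7 h8 by algebra
  finally show ?thesis .
qed

lemma h14: "h 14 = a ^ 183 * b ^ 85 * c ^ 73"
proof -
  have "(a ^ 183 * b ^ 85 * c ^ 73) * h 2 = h 7 * (h 9 * h 6 ^ 2 - h 5 * h 8 ^ 2)"
    unfolding h2 h5 h6 h7 h8 h9 power_zero_numeral by algebra
  then show ?thesis
    using h_evenI[of 7] by simp
qed

lemma h15: "h 15 = - (a ^ 210 * b ^ 98 * c ^ 84)"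
proof -
  have "h 15 = h 9 * h 7 ^ 3 - h 6 * h 8 ^ 3"
    using h_odd[of 7] by simp
  also have "\<dots> = - (a ^ 210 * b ^ 98 * c ^ 84)"
    unfolding h6 h7 h8 h9 power_zero_numeral by algebra
  finally show ?thesis .
qed

lemma h16: "h 16 = 0"
proof -
  have "0 * h 2 = h 8 * (h 10 * h 7 ^ 2 - h 6 * h 9 ^ 2)"
    unfolding h2 h6 h7 h8 h9 h10 by algebra
  then show ?thesis
    using h_evenI[of 8] by simp
qed

lemma h17: "h 17 = a ^ 270 * b ^ 126 * c ^ 108"
proof -
  have "h 17 = h 10 * h 8 ^ 3 - h 7 * h 9 ^ 3"
    using h_odd[of 8] by simp
  also have "\<dots> = a ^ 270 * b ^ 126 * c ^ 108"
    unfolding h7 h8 h9 h10 power_zero_numeral by algebra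
  finally show ?thesis .
qed

lemma h18: "h 18 = - (a ^ 303 * b ^ 141 * c ^ 121)"
proof -
  have "(- (a ^ 303 * b ^ 141 * c ^ 121)) * h 2 = h 9 * (h 11 * h 8 ^ 2 - h 7 * h 10 ^ 2)"
    unfolding h2 h7 h8 h9 h10 h11 power_zero_numeral by algebra
  then show ?thesis
    using h_evenI[of 9] by simp
qed

lemma h19: "h 19 = - (a ^ 338 * b ^ 157 * c ^ 135)"
proof -
  have "h 19 = h 11 * h 9 ^ 3 - h 8 * h 10 ^ 3"
    using h_odd[of 9] by simp
  also have "\<dots> = - (a ^ 338 * b ^ 157 * c ^ 135)"
    unfolding h8 h9 h10 h11 by algebra
  finally show ?thesis .
qed

lemma h20: "h 20 = a ^ 374 * b ^ 174 * c ^ 150"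
proof -
  have "(a ^ 374 * b ^ 174 * c ^ 150) * h 2 = h 10 * (h 12 * h 9 ^ 2 - h 8 * h 11 ^ 2)"
    unfolding h2 h8 h9 h10 h11 h12 by algebra
  then show ?thesis
    using h_evenI[of 10] by simp
qed

section \<open>Quasi-periodicity with shifts 8 and 24\<close>

text \<open>The ratio \<open>h (n + 8) / h n\<close> is geometric in \<open>n\<close> where it is
  defined, and \<open>V\<close> is its quotient, found as \<open>h 10 / h 2\<close> divided by
  \<open>h 9 / h 1\<close>.\<close>

definition V :: 'a where
  "V = - (a ^ 15 * b ^ 7 * c ^ 6)"

text \<open>The bound is 12 because the induction step also applies a recurrence at index
  \<open>n - 8\<close>, and the recurrences start at index 5.\<close>

lemma h_add_8_base:
  assumes "n \<le> 12"
  shows "h (n + 8) = - (V ^ (n + 4)) * h n"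
proof -
  have b0: "h 8 = - (V ^ 4) * h 0"
    unfolding h0 h8 V_def by algebra
  have b1: "h 9 = - (V ^ 5) * h 1"
    unfolding h1 h9 V_def by algebra
  have b2: "h 10 = - (V ^ 6) * h 2"
    unfolding h2 h10 V_def by algebra
  have b3: "h 11 = - (V ^ 7) * h 3"
    unfolding h3 h11 V_def by algebra
  have b4: "h 12 = - (V ^ 8) * h 4"
    unfolding h4 h12 V_def by algebra
  have b5: "h 13 = - (V ^ 9) * h 5"
    unfolding h5 h13 V_def by algebra
  have b6: "h 14 = - (V ^ 10) * h 6"
    unfolding h6 h14 V_def by algebra
  have b7: "h 15 = - (V ^ 11) * h 7"
    unfolding h7 h15 V_def by algebra
  have b8: "h 16 = - (V ^ 12) * h 8"
    unfolding h8 h16 V_def by algebra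
  have b9: "h 17 = - (V ^ 13) * h 9"
    unfolding h9 h17 V_def by algebra
  have b10: "h 18 = - (V ^ 14) * h 10"
    unfolding h10 h18 V_def by algebra
  have b11: "h 19 = - (V ^ 15) * h 11"
    unfolding h11 h19 V_def by algebra
  have b12: "h 20 = - (V ^ 16) * h 12"
    unfolding h12 h20 V_def by algebra
  have "n \<in> {0, 1, 2, 3, 4, 5, 6, 7, 8, 9, 10, 11, 12}"
    using assms unfolding insert_iff empty_iff by presburger
  then show ?thesis
    using b0 b1 b2 b3 b4 b5 b6 b7 b8 b9 b10 b11 b12 by auto
qed

text \<open>Shifting all arguments of a recurrence by 8 raises its index by 16. The step therefore
  relates \<open>h (n + 8)\<close> to \<open>h (n - 8)\<close>, and the induction hypothesis at
  \<open>n - 8\<close> leads back to \<open>h n\<close>.\<close>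

lemma h_add_8: "h (n + 8) = - (V ^ (n + 4)) * h n"
proof (induction n rule: less_induct)
  case (less n)
  have "n \<le> 12 \<or> (\<exists>j. n = 2 * j + 13) \<or> (\<exists>j. n = 2 * j + 14)"
    by presburger
  then consider (base) "n \<le> 12" | (odd) j where "n = 2 * j + 13" | (even) j where "n = 2 * j + 14"
    by blast
  then show ?case
  proof cases
    case base
    then show ?thesis by (rule h_add_8_base)
  next
    case odd
    have IH: "h (i + 8) = - (V ^ (i + 4)) * h i" if "i < 2 * j + 13" for i
      using less that odd by blast
    have IH_shift: "h (j + 9) = - (V ^ j * V ^ 5) * h (j + 1)"
      "h (j + 10) = - (V ^ j * V ^ 6) * h (j + 2)"
      "h (j + 11) = - (V ^ j * V ^ 7) * h (j + 3)"
      "h (j + 12) = - (V ^ j * V ^ 8) * h (j + 4)"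
      using IH[of "j + 1"] IH[of "j + 2"] IH[of "j + 3"] IH[of "j + 4"]
      by (simp_all add: power_add add.commute)
    have "h (n + 8) = h (j + 12) * h (j + 10) ^ 3 - h (j + 9) * h (j + 11) ^ 3"
      using h_odd[of "j + 10"] by (simp add: odd algebra_simps)
    \<comment> \<open>Both products have four factors, so the signs cancel, and both collect the
      same power: \<open>(j + 8) + 3 * (j + 6) = (j + 5) + 3 * (j + 7)\<close>.\<close>
    also have "\<dots> = ((V ^ j) ^ 4 * V ^ 26) * (h (j + 4) * h (j + 2) ^ 3 - h (j + 1) * h (j + 3) ^ 3)"
      unfolding IH_shift by algebra
    also have "(V ^ j) ^ 4 * V ^ 26 = V ^ (4 * j + 26)"
      by (simp add: mult.commute flip: power_add power_mult)
    also have "h (j + 4) * h (j + 2) ^ 3 - h (j + 1) * h (j + 3) ^ 3 = h (2 * j + 5)"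
      using h_odd[of "j + 2"] by (simp add: eval_nat_numeral)
    \<comment> \<open>The exponent splits as \<open>(2 * j + 17) + (2 * j + 9)\<close>; the second
      part is absorbed by the hypothesis at \<open>2 * j + 5\<close>.\<close>
    also have "V ^ (4 * j + 26) * h (2 * j + 5) = - (V ^ (n + 4)) * h (2 * j + 13)"
      using IH[of "2 * j + 5"] by (simp add: odd add.commute flip: power_add mult.assoc)
    finally show ?thesis by (simp add: odd add.commute)
  next
    case even
    have IH: "h (i + 8) = - (V ^ (i + 4)) * h i" if "i < 2 * j + 14" for i
      using less that even by blast
    have IH_shift: "h (j + 9) = - (V ^ j * V ^ 5) * h (j + 1)"
      "h (j + 10) = - (V ^ j * V ^ 6) * h (j + 2)"
      "h (j + 11) = - (V ^ j * V ^ 7) * h (j + 3)"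
      "h (j + 12) = - (V ^ j * V ^ 8) * h (j + 4)"
      "h (j + 13) = - (V ^ j * V ^ 9) * h (j + 5)"
      using IH[of "j + 1"] IH[of "j + 2"] IH[of "j + 3"] IH[of "j + 4"] IH[of "j + 5"]
      by (simp_all add: power_add add.commute)
    have "h (n + 8) =
        h (j + 11) * (h (j + 13) * h (j + 10) ^ 2 - h (j + 9) * h (j + 12) ^ 2) / h 2"
      using h_even[of "j + 11"] by (simp add: even algebra_simps)
    \<comment> \<open>The divisor \<open>h 2\<close> is not shifted, so again only four factors
      contribute; either product yields the exponent \<open>4 * j + 28\<close>.\<close>
    also have "\<dots> = ((V ^ j) ^ 4 * V ^ 28) *
        (h (j + 3) * (h (j + 5) * h (j + 2) ^ 2 - h (j + 1) * h (j + 4) ^ 2) / h 2)"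
      unfolding IH_shift by algebra
    also have "(V ^ j) ^ 4 * V ^ 28 = V ^ (4 * j + 28)"
      by (simp add: mult.commute flip: power_add power_mult)
    also have "h (j + 3) * (h (j + 5) * h (j + 2) ^ 2 - h (j + 1) * h (j + 4) ^ 2) / h 2 = h (2 * j + 6)"
      using h_even[of "j + 3"] by (simp add: eval_nat_numeral)
    also have "V ^ (4 * j + 28) * h (2 * j + 6) = - (V ^ (n + 4)) * h (2 * j + 6 + 8)"
      using IH[of "2 * j + 6"] by (simp add: even add.commute flip: power_add mult.assoc)
    finally show ?thesis by (simp add: even add.commute)
  qed
qed

lemma h_add_24: "h (n + 24) = (- (V ^ (n + 12))) ^ 3 * h n"
proof -
  have "h (n + 24) = - (V ^ (n + 20) * (V ^ (n + 12) * V ^ (n + 4))) * h n"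
    using h_add_8[of n] h_add_8[of "n + 8"] h_add_8[of "n + 16"] by (simp add: add.commute)
  \<comment> \<open>The three exponents are in arithmetic progression with mean
    \<open>n + 12\<close>, which makes the product a cube.\<close>
  also have "V ^ (n + 20) * (V ^ (n + 12) * V ^ (n + 4)) = (V ^ (n + 12)) ^ 3"
    by (simp add: mult.commute flip: power_add power_mult)
  finally show ?thesis by simp
qed

text \<open>The residues 21 and 23 lie beyond the terms computed from the recurrences and are
  reached from 13 and 15 by the shift.\<close>

lemma h21: "h 21 = a ^ 413 * b ^ 192 * c ^ 165"
  using h_add_8[of 13, simplified] unfolding h13 V_def by algebra

lemma h23: "h 23 = - (a ^ 495 * b ^ 231 * c ^ 198)"
  using h_add_8[of 15, simplified] unfolding h15 V_def by algebra

end

section \<open>Cubes of nonzero integers\<close>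

text \<open>Since \<open>of_int\<close> is injective in characteristic 0, questions about rational
  terms can be settled in the integers.\<close>

lemma is_cube_of_int [simp]: "is_cube (of_int x :: 'a::ring_char_0) \<longleftrightarrow> is_cube x"
  unfolding is_cube_def by (simp only: of_int_eq_iff of_int_eq_id id_apply)

text \<open>For the cancellation, \<open>w ^ 3 dvd \<beta> ^ 3\<close> forces
  \<open>w dvd \<beta>\<close>, and the cofactor is a cube root of \<open>x\<close>.\<close>

lemma is_cube_cube_mult_iff:
  fixes x :: int
  assumes "w \<noteq> 0"
  shows "is_cube (w ^ 3 * x) \<longleftrightarrow> is_cube x"
proof
  assume "is_cube (w ^ 3 * x)"
  then obtain \<beta> where \<beta>: "\<beta> \<noteq> 0" "w ^ 3 * x = \<beta> ^ 3"
    by (auto simp: is_cube_def)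
  then have "w ^ 3 dvd \<beta> ^ 3"
    by (metis dvd_triv_left)
  then obtain \<gamma> where "\<beta> = w * \<gamma>"
    by (auto simp: pow_divides_pow_iff)
  with \<beta> assms show "is_cube x"
    by (auto simp: is_cube_def power_mult_distrib)
next
  assume "is_cube x"
  then obtain \<beta> where "\<beta> \<noteq> 0" "x = \<beta> ^ 3"
    by (auto simp: is_cube_def)
  with assms show "is_cube (w ^ 3 * x)"
    unfolding is_cube_def by (intro exI[of _ "w * \<beta>"]) (simp add: power_mult_distrib)
qed

text \<open>From \<open>x\<^sup>2 = \<beta> ^ 3\<close> it follows that
  \<open>\<beta> ^ 3 * x = x ^ 3\<close>, and the cube \<open>\<beta> ^ 3\<close> can be
  cancelled.\<close>

lemma is_cube_square_iff:
  fixes x :: int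
  assumes "x \<noteq> 0"
  shows "is_cube (x\<^sup>2) \<longleftrightarrow> is_cube x"
proof
  assume "is_cube (x\<^sup>2)"
  then obtain \<beta> where \<beta>: "\<beta> \<noteq> 0" "x\<^sup>2 = \<beta> ^ 3"
    by (auto simp: is_cube_def)
  have "\<beta> ^ 3 * x = x ^ 3 * 1"
    using \<beta>(2) by algebra
  moreover have "is_cube (x ^ 3 * 1)"
    using assms by (auto simp: is_cube_def)
  ultimately show "is_cube x"
    using is_cube_cube_mult_iff[OF \<beta>(1)] by metis
next
  assume "is_cube x"
  then obtain \<beta> where "\<beta> \<noteq> 0" "x = \<beta> ^ 3"
    by (auto simp: is_cube_def)
  then show "is_cube (x\<^sup>2)"
    unfolding is_cube_def by (intro exI[of _ "\<beta>\<^sup>2"]) simp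
qed

section \<open>Reduction modulo 24 and the residue classes\<close>

theorem theorem5p13:
  fixes \<alpha> :: int and h :: "nat \<Rightarrow> rat"
  assumes alpha: "\<alpha> \<notin> {0, 1}"
    and h0: "h 0 = 0"
    and h1: "h 1 = 1"
    and h2: "h 2 = of_int (- (\<alpha> ^ 3 * (\<alpha> - 1) * (2 * \<alpha> - 1)))"
    and h3: "h 3 = of_int (- (\<alpha> ^ 8 * (\<alpha> - 1) ^ 3 * (2 * \<alpha> - 1) ^ 3))"
    and h4: "h 4 = of_int (\<alpha> ^ 14 * (\<alpha> - 1) ^ 6 * (2 * \<alpha> - 1) ^ 6)"
    and h_odd: "\<And>m. m \<ge> 2 \<Longrightarrow>
      h (2 * m + 1) = h (m + 2) * h m ^ 3 - h (m - 1) * h (m + 1) ^ 3"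
    and h_even: "\<And>m. m \<ge> 3 \<Longrightarrow>
      h (2 * m) = h m * (h (m + 2) * h (m - 1) ^ 2 - h (m - 2) * h (m + 1) ^ 2) / h 2"
  shows "(\<forall>n. [n = 1] (mod 24) \<or> [n = 7] (mod 24) \<or> [n = 17] (mod 24) \<or> [n = 23] (mod 24)
              \<longrightarrow> is_cube (h n))
       \<and> (\<forall>n. [n = 3] (mod 24) \<or> [n = 4] (mod 24) \<or> [n = 20] (mod 24) \<or> [n = 21] (mod 24)
              \<longrightarrow> (is_cube (h n) \<longleftrightarrow> is_cube \<alpha>))
       \<and> (\<forall>n. [n = 6] (mod 24) \<or> [n = 18] (mod 24)
              \<longrightarrow> (is_cube (h n) \<longleftrightarrow> is_cube (2 * \<alpha> - 1)))
       \<and> (\<forall>n. [n = 9] (mod 24) \<or> [n = 15] (mod 24)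
              \<longrightarrow> (is_cube (h n) \<longleftrightarrow> is_cube (\<alpha> - 1)))"
proof -
  define b where "b = \<alpha> - 1"
  define c where "c = 2 * \<alpha> - 1"
  \<comment> \<open>\<open>c\<close> is nonzero because it is odd.\<close>
  have nz: "\<alpha> \<noteq> 0" "b \<noteq> 0" "c \<noteq> 0"
    using alpha unfolding b_def c_def by (simp, simp, presburger)
  interpret order_8_eds "of_int \<alpha>" "of_int b" "of_int c" h
  proof
    show "h 2 = - (of_int \<alpha> ^ 3 * of_int b * of_int c)"
      "h 3 = - (of_int \<alpha> ^ 8 * of_int b ^ 3 * of_int c ^ 3)"
      "h 4 = of_int \<alpha> ^ 14 * of_int b ^ 6 * of_int c ^ 6"
      using h2 h3 h4 by (simp_all add: b_def c_def)
  qed (use nz h0 h1 h_odd h_even in \<open>simp_all add: b_def c_def\<close>)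
  have V_int: "V = of_int (- (\<alpha> ^ 15 * b ^ 7 * c ^ 6))"
    by (simp add: V_def)
  \<comment> \<open>Each step of 24 contributes the cube of the nonzero integer \<open>?v\<close>;
    the existential hides the accumulated exponent.\<close>
  have shift: "\<exists>u. u \<noteq> 0 \<and> h (24 * q + s) = of_int (u ^ 3) * h s" for q s
  proof (induction q)
    case 0
    show ?case by (intro exI[of _ 1]) simp
  next
    case (Suc q)
    then obtain u where u: "u \<noteq> 0" "h (24 * q + s) = of_int (u ^ 3) * h s"
      by blast
    let ?v = "- ((- (\<alpha> ^ 15 * b ^ 7 * c ^ 6)) ^ (24 * q + s + 12))"
    have "h (24 * Suc q + s) = of_int (?v ^ 3) * h (24 * q + s)"
      using h_add_24[of "24 * q + s"] unfolding V_int by (simp add: algebra_simps)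
    then have "h (24 * Suc q + s) = of_int ((?v * u) ^ 3) * h s"
      unfolding u(2) by (simp add: power_mult_distrib)
    moreover have "?v * u \<noteq> 0"
      using nz u(1) by simp
    ultimately show ?case by blast
  qed
  have cube_iff: "is_cube (h n) \<longleftrightarrow> is_cube y"
    if n: "[n = s] (mod 24)" and s: "s < 24" and hs: "h s = of_int (w ^ 3 * y)" and w: "w \<noteq> 0"
    for n s and w y :: int
  proof -
    have "n = 24 * (n div 24) + s"
      using n s mult_div_mod_eq[of 24 n] by (simp add: cong_def)
    then obtain u where u: "u \<noteq> 0" "h n = of_int (u ^ 3) * h s"
      using shift by metis
    have "h n = of_int (u ^ 3 * (w ^ 3 * y))"
      unfolding u(2) hs by simp
    then show ?thesis
      by (simp only: is_cube_of_int is_cube_cube_mult_iff[OF u(1)] is_cube_cube_mult_iff[OF w])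
  qed
  have is_cube_1: "is_cube (1 :: int)"
    unfolding is_cube_def by (intro exI[of _ 1]) simp
  have r1: "is_cube (h n)" if "[n = 1] (mod 24)" for n
    using h1 cube_iff[OF that, of "1" "1"] is_cube_1 by simp
  \<comment> \<open>In every case below \<open>w\<close> takes the exponents of \<open>h s\<close>
    divided by 3 and rounded down, and absorbs the sign since -1 is a cube; \<open>y\<close> is what
    remains. In classes 7, 17, 23 all exponents are multiples of 3.\<close>
  have r7: "is_cube (h n)" if "[n = 7] (mod 24)" for n
    using cube_iff[OF that, of "- (\<alpha> ^ 15 * b ^ 7 * c ^ 6)" "1"] nz
    by (simp add: h7 is_cube_1 power_mult_distrib flip: power_mult)
  have r17: "is_cube (h n)" if "[n = 17] (mod 24)" for n
    using cube_iff[OF that, of "\<alpha> ^ 90 * b ^ 42 * c ^ 36" "1"] nz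
    by (simp add: h17 is_cube_1 power_mult_distrib flip: power_mult)
  have r23: "is_cube (h n)" if "[n = 23] (mod 24)" for n
    using cube_iff[OF that, of "- (\<alpha> ^ 165 * b ^ 77 * c ^ 66)" "1"] nz
    by (simp add: h23 is_cube_1 power_mult_distrib flip: power_mult)
  \<comment> \<open>In classes 3, 4, 20, 21 only the exponent of \<alpha> is not a multiple of 3; it
    is 2 modulo 3, which leaves a square.\<close>
  have r3: "is_cube (h n) \<longleftrightarrow> is_cube \<alpha>" if "[n = 3] (mod 24)" for n
    using cube_iff[OF that, of "- (\<alpha> ^ 2 * b ^ 1 * c ^ 1)" "\<alpha>\<^sup>2"] nz
    by (simp add: h3 is_cube_square_iff power_mult_distrib flip: power_mult)
  have r4: "is_cube (h n) \<longleftrightarrow> is_cube \<alpha>" if "[n = 4] (mod 24)" for n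
    using cube_iff[OF that, of "\<alpha> ^ 4 * b ^ 2 * c ^ 2" "\<alpha>\<^sup>2"] nz
    by (simp add: h4 is_cube_square_iff power_mult_distrib flip: power_mult)
  have r20: "is_cube (h n) \<longleftrightarrow> is_cube \<alpha>" if "[n = 20] (mod 24)" for n
    using cube_iff[OF that, of "\<alpha> ^ 124 * b ^ 58 * c ^ 50" "\<alpha>\<^sup>2"] nz
    by (simp add: h20 is_cube_square_iff power_mult_distrib flip: power_mult)
  have r21: "is_cube (h n) \<longleftrightarrow> is_cube \<alpha>" if "[n = 21] (mod 24)" for n
    using cube_iff[OF that, of "\<alpha> ^ 137 * b ^ 64 * c ^ 55" "\<alpha>\<^sup>2"] nz
    by (simp add: h21 is_cube_square_iff power_mult_distrib flip: power_mult)
  \<comment> \<open>Here only \<open>c\<close> remains, with exponent 1 modulo 3.\<close>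
  have r6: "is_cube (h n) \<longleftrightarrow> is_cube c" if "[n = 6] (mod 24)" for n
    using cube_iff[OF that, of "- (\<alpha> ^ 11 * b ^ 5 * c ^ 4)" "c"] nz
    by (simp add: h6  power_mult_distrib flip: power_mult power_Suc2)
  have r18: "is_cube (h n) \<longleftrightarrow> is_cube c" if "[n = 18] (mod 24)" for n
    using cube_iff[OF that, of "- (\<alpha> ^ 101 * b ^ 47 * c ^ 40)" "c"] nz
    by (simp add: h18  power_mult_distrib flip: power_mult power_Suc2)
  \<comment> \<open>Here only \<open>b\<close> remains, with exponent 2 modulo 3.\<close>
  have r9: "is_cube (h n) \<longleftrightarrow> is_cube b" if "[n = 9] (mod 24)" for n
    using cube_iff[OF that, of "\<alpha> ^ 25 * b ^ 11 * c ^ 10" "b\<^sup>2"] nz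
    by (simp add: h9 is_cube_square_iff power_mult_distrib flip: power_mult)
  have r15: "is_cube (h n) \<longleftrightarrow> is_cube b" if "[n = 15] (mod 24)" for n
    using cube_iff[OF that, of "- (\<alpha> ^ 70 * b ^ 32 * c ^ 28)" "b\<^sup>2"] nz
    by (simp add: h15 is_cube_square_iff power_mult_distrib flip: power_mult)
  show ?thesis
    using r1 r7 r17 r23 r3 r4 r20 r21 r6 r18 r9 r15
    unfolding b_def c_def by blast
qed

end
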